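(* Let $\alpha>0$, $\beta>1$, let $f(u)=u\log u$, and let $\widetilde f_\beta$ be the partially linearized function associated with $f$ and $\beta$. Let $v:\mathcal S\to\mathbb R$ and let $$e_v(s,a)=\log\frac{d^E(s,a)}{d^U(s,a)}+\gamma\sum_{s'}T(s'|s,a)v(s')-v(s).$$ For $\omega:\mathcal S\times\mathcal A\to[0,\infty)$ define $$h(\omega(s,a))=\omega(s,a)e_v(s,a)-\omega(s,a)\log(\omega(s,a))-\alpha\,\widetilde f_\beta(\omega(s,a)),$$ $$L_{\alpha,\beta}(\omega,v)=\mathbb E_{(s,a)\sim d^U}[h(\omega(s,a))]+(1-\gamma)\,\mathbb E_{s\sim p_0}[v(s)].$$ Then the solution $\omega_v^*=\arg\max_{\omega\ge 0}L_{\alpha,\beta}(\omega,v)$ is $$\omega_v^*(s,a)=\begin{cases}\exp\left(\frac{e_v(s,a)}{1+\alpha}-1\right)&\text{if } \frac{e_v(s,a)}{\alpha+1}>\log\beta+1,\\[4pt] \exp\left(e_v(s,a)-1-\alpha(\log\beta+1)\right)&\text{otherwise,}\end{cases}$$ and moreover $$h(\omega_v^*(s,a))=\begin{cases}(1+\alpha)\exp\left(\frac{e_v(s,a)}{1+\alpha}-1\right)+C_1&\text{if } \frac{e_v(s,a)}{\alpha+1}>\log\beta+1,\\[4pt] \exp\left(e_v(s,a)-1-\alpha(\log\beta+1)\right)+C_2&\text{otherwise,}\end{cases}$$ where $C_1=-\alpha C_{f,\beta}$ and $C_2=\alpha(\log\beta+1)$ are constants with respect to $\omega$ and $v$.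
   Context: Setting: a Markov decision process with state set $\mathcal S$ and action set $\mathcal A$ (countable, finite or infinite; sums are over these sets), transition probabilities $T(s'|s,a)$, initial state distribution $p_0$ on $\mathcal S$, and discount factor $\gamma\in[0,1)$. $d^E$ and $d^U$ are probability distributions on $\mathcal S\times\mathcal A$ with $d^E(s,a)>0$ and $d^U(s,a)>0$ for all $(s,a)$, namely the occupancy measures of an expert policy and of a behavior policy. The occupancy measure of a policy $\pi$ is $d^\pi(s,a)=(1-\gamma)\sum_{t\ge0}\gamma^t\Pr(s_t=s,a_t=a)$ with $s_0\sim p_0$, $a_t\sim\pi(\cdot|s_t)$, $s_{t+1}\sim T(\cdot|s_t,a_t)$. Partially linearized function: for $\beta>1$ and a strictly convex continuous $f:\mathbb R_+\to\mathbb R$ with $f(1)=0$ (differentiable at $\beta$), $$\widetilde f_\beta(u)=\begin{cases}f(u)+C_{f,\beta}&\text{if }u\ge\beta,\\ f'(\beta)u-f'(\beta)&\text{if }u<\beta,\end{cases}\qquad C_{f,\beta}=-f(\beta)+f'(\beta)(\beta-1).$$ Conventions: $\log$ is the natural logarithm and $0\log0=0$. All sums and expectations appearing are assumed to converge absolutely (automatic when $\mathcal S$ and $\mathcal A$ are finite): this applies to those involving $v$ and to $\mathbb E_{d^U}[h(\omega_v^*(s,a))]$ for the function $\omega^*_v$ displayed in the claim, and $\omega$ in the maximization ranges over all functions $\omega\ge0$ for which $\mathbb E_{d^U}[h(\omega(s,a))]$ converges absolutely. *)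

theory Defs
  imports "HOL-Probability.Probability"
begin

text \<open>
  A Markov decision process has state type \<open>'s\<close>, action type \<open>'a\<close>, initial distribution \<open>p0\<close> and
  transition kernel \<open>T\<close>, where \<open>pmf (T s a) s'\<close> is the probability \<open>T(s'|s,a)\<close>. A policy is a map
  \<open>\<pi>\<close> from states to distributions over actions.

  \<open>state_action_pmf p0 T \<pi> t\<close> is the law of \<open>(s_t, a_t)\<close> when \<open>s_0 \<sim> p0\<close>,
  \<open>a_t \<sim> \<pi>(\<cdot>|s_t)\<close> and \<open>s_(t+1) \<sim> T(\<cdot>|s_t,a_t)\<close>.
\<close>

primrec state_action_pmf ::
  "'s pmf \<Rightarrow> ('s \<Rightarrow> 'a \<Rightarrow> 's pmf) \<Rightarrow> ('s \<Rightarrow> 'a pmf) \<Rightarrow> nat \<Rightarrow> ('s \<times> 'a) pmf" where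
  "state_action_pmf p0 T \<pi> 0 = bind_pmf p0 (\<lambda>s. map_pmf (Pair s) (\<pi> s))"
| "state_action_pmf p0 T \<pi> (Suc t) =
     bind_pmf (state_action_pmf p0 T \<pi> t)
       (\<lambda>(s, a). bind_pmf (T s a) (\<lambda>s'. map_pmf (Pair s') (\<pi> s')))"

definition occupancy ::
  "real \<Rightarrow> 's pmf \<Rightarrow> ('s \<Rightarrow> 'a \<Rightarrow> 's pmf) \<Rightarrow> ('s \<Rightarrow> 'a pmf) \<Rightarrow> 's \<times> 'a \<Rightarrow> real" where
  "occupancy \<gamma> p0 T \<pi> x = (1 - \<gamma>) * (\<Sum>t. \<gamma> ^ t * pmf (state_action_pmf p0 T \<pi> t) x)"

definition lin_const :: "(real \<Rightarrow> real) \<Rightarrow> real \<Rightarrow> real" where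
  "lin_const f \<beta> = - f \<beta> + deriv f \<beta> * (\<beta> - 1)"

definition partial_lin :: "(real \<Rightarrow> real) \<Rightarrow> real \<Rightarrow> real \<Rightarrow> real" where
  "partial_lin f \<beta> u =
     (if u \<ge> \<beta> then f u + lin_const f \<beta> else deriv f \<beta> * u - deriv f \<beta>)"

text \<open>The convention \<open>0 log 0 = 0\<close> holds because the product has a factor \<open>0\<close>.\<close>

definition xlog :: "real \<Rightarrow> real" where
  "xlog u = u * ln u"

definition e_fun ::
  "real \<Rightarrow> ('s \<Rightarrow> 'a \<Rightarrow> 's pmf) \<Rightarrow> ('s \<times> 'a) pmf \<Rightarrow> ('s \<times> 'a) pmf \<Rightarrow> ('s \<Rightarrow> real)
     \<Rightarrow> 's \<times> 'a \<Rightarrow> real" where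
  "e_fun \<gamma> T dE dU v = (\<lambda>(s, a).
     ln (pmf dE (s, a) / pmf dU (s, a)) + \<gamma> * (\<Sum>\<^sub>\<infinity>s'. pmf (T s a) s' * v s') - v s)"

text \<open>
  The integrand \<open>h\<close> depends on \<open>(s,a)\<close> only through \<open>e = e_v(s,a)\<close> and \<open>w = \<omega>(s,a)\<close>;
  both are scalar arguments here.
\<close>

definition h_fun :: "real \<Rightarrow> real \<Rightarrow> real \<Rightarrow> real \<Rightarrow> real" where
  "h_fun \<alpha> \<beta> e w = w * e - w * ln w - \<alpha> * partial_lin xlog \<beta> w"

definition L_obj ::
  "real \<Rightarrow> real \<Rightarrow> real \<Rightarrow> 's pmf \<Rightarrow> ('s \<Rightarrow> 'a \<Rightarrow> 's pmf) \<Rightarrow> ('s \<times> 'a) pmf \<Rightarrow> ('s \<times> 'a) pmf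
     \<Rightarrow> ('s \<times> 'a \<Rightarrow> real) \<Rightarrow> ('s \<Rightarrow> real) \<Rightarrow> real" where
  "L_obj \<alpha> \<beta> \<gamma> p0 T dE dU \<omega> v =
     measure_pmf.expectation dU (\<lambda>x. h_fun \<alpha> \<beta> (e_fun \<gamma> T dE dU v x) (\<omega> x))
     + (1 - \<gamma>) * measure_pmf.expectation p0 v"

text \<open>
  Integrability against a pmf is absolute convergence of the corresponding sum. Without it the
  expectation in \<open>L_obj\<close> would be the default value \<open>0\<close>.
\<close>

definition admissible ::
  "real \<Rightarrow> real \<Rightarrow> real \<Rightarrow> ('s \<Rightarrow> 'a \<Rightarrow> 's pmf) \<Rightarrow> ('s \<times> 'a) pmf \<Rightarrow> ('s \<times> 'a) pmf
     \<Rightarrow> ('s \<Rightarrow> real) \<Rightarrow> ('s \<times> 'a \<Rightarrow> real) \<Rightarrow> bool" where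
  "admissible \<alpha> \<beta> \<gamma> T dE dU v \<omega> \<longleftrightarrow>
     (\<forall>x. \<omega> x \<ge> 0) \<and>
     integrable (measure_pmf dU) (\<lambda>x. h_fun \<alpha> \<beta> (e_fun \<gamma> T dE dU v x) (\<omega> x))"

definition omega_star ::
  "real \<Rightarrow> real \<Rightarrow> real \<Rightarrow> ('s \<Rightarrow> 'a \<Rightarrow> 's pmf) \<Rightarrow> ('s \<times> 'a) pmf \<Rightarrow> ('s \<times> 'a) pmf
     \<Rightarrow> ('s \<Rightarrow> real) \<Rightarrow> 's \<times> 'a \<Rightarrow> real" where
  "omega_star \<alpha> \<beta> \<gamma> T dE dU v = (\<lambda>x. let e = e_fun \<gamma> T dE dU v x in
     if e / (\<alpha> + 1) > ln \<beta> + 1 then exp (e / (1 + \<alpha>) - 1)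
     else exp (e - 1 - \<alpha> * (ln \<beta> + 1)))"

end

theory Submission
  imports Defs
begin

text \<open>
  Both \<open>w ln w\<close> and the partially linearized function lie above their tangents. Taken at the claimed
  maximizer, the two tangent bounds add up to an upper bound of \<open>h_fun\<close> whose linear terms in \<open>w\<close>
  cancel, and the tangent bound for \<open>w ln w\<close> is strict elsewhere. So the integrand is maximized
  pointwise and uniquely; as \<open>dU\<close> has full support, the integral inherits uniqueness.
\<close>

text \<open>Applies \<open>ln x \<le> x - 1\<close>, an equality only at \<open>x = 1\<close>, to
  \<open>x = exp (c - 1) / w\<close>. The tangent is indexed by its slope \<open>c\<close> rather
  than by its contact point \<open>exp (c - 1)\<close>, so that slopes can later be added up to
  \<open>e\<close>.\<close>

lemma xlog_ge_tangent:
  fixes w c :: real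
  assumes "w \<ge> 0"
  shows "w * ln w \<ge> c * w - exp (c - 1)"
    and "w * ln w = c * w - exp (c - 1) \<longleftrightarrow> w = exp (c - 1)"
proof -
  have eq: "w * ln w = c * w - exp (c - 1)" if "w = exp (c - 1)"
    using that by (simp add: algebra_simps)
  have less: "w * ln w > c * w - exp (c - 1)" if "w \<noteq> exp (c - 1)"
  proof (cases "w = 0")
    case False
    with assms have w: "w > 0" by simp
    have "ln (exp (c - 1) / w) < exp (c - 1) / w - 1"
      using ln_eq_minus_one[of "exp (c - 1) / w"] ln_le_minus_one[of "exp (c - 1) / w"] w that
      by (fastforce simp: less_le)
    then have "w * (c - 1 - ln w) < w * (exp (c - 1) / w - 1)"
      using w by (simp add: ln_div)
    then show ?thesis
      using w by (simp add: algebra_simps)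
  qed simp
  show "w * ln w \<ge> c * w - exp (c - 1)"
    using eq less by fastforce
  show "w * ln w = c * w - exp (c - 1) \<longleftrightarrow> w = exp (c - 1)"
    using eq less by fastforce
qed

lemma deriv_xlog:
  assumes "x > 0"
  shows "deriv xlog x = ln x + 1"
proof (rule DERIV_imp_deriv)
  show "(xlog has_real_derivative ln x + 1) (at x)"
    unfolding xlog_def[abs_def] using assms by (auto intro!: derivative_eq_intros)
qed

lemma lin_const_xlog:
  assumes "\<beta> > 0"
  shows "lin_const xlog \<beta> = \<beta> - ln \<beta> - 1"
  using assms by (simp add: lin_const_def deriv_xlog xlog_def algebra_simps)

lemma partial_lin_xlog:
  assumes "\<beta> > 0"
  shows "partial_lin xlog \<beta> u =
    (if u \<ge> \<beta> then u * ln u + lin_const xlog \<beta> else (ln \<beta> + 1) * (u - 1))"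
  using assms by (simp add: partial_lin_def deriv_xlog xlog_def algebra_simps)

text \<open>Beyond \<open>\<beta>\<close> the excess over the extended linear branch is the gap
  between \<open>u * ln u\<close> and its tangent of slope \<open>ln \<beta> + 1\<close>, whose
  contact point is \<open>\<beta>\<close>.\<close>

lemma partial_lin_xlog_ge_linear:
  assumes "\<beta> > 0" "u \<ge> 0"
  shows "partial_lin xlog \<beta> u \<ge> (ln \<beta> + 1) * (u - 1)"
  using assms xlog_ge_tangent(1)[of u "ln \<beta> + 1"]
  by (simp add: partial_lin_xlog lin_const_xlog algebra_simps)

text \<open>The condition on \<open>c\<close> puts the contact point \<open>exp (c - 1)\<close> at
  or beyond \<open>\<beta>\<close>, hence on the entropic branch.\<close>

lemma partial_lin_xlog_ge_tangent:
  assumes "\<beta> > 0" "u \<ge> 0" "c \<ge> ln \<beta> + 1"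
  shows "partial_lin xlog \<beta> u \<ge> c * u - exp (c - 1) + lin_const xlog \<beta>"
proof (cases "u \<ge> \<beta>")
  case True
  then show ?thesis
    using assms xlog_ge_tangent(1)[of u c] by (simp add: partial_lin_xlog)
next
  case False
  \<comment> \<open>The tangent is at least as steep as the linear branch, so below
    \<open>\<beta>\<close> the gap between them is smallest at \<open>\<beta>\<close>, where the
    tangent bound for \<open>\<beta> * ln \<beta>\<close> settles it.\<close>
  have "(c - (ln \<beta> + 1)) * u \<le> (c - (ln \<beta> + 1)) * \<beta>"
    using False assms by (intro mult_left_mono) auto
  then show ?thesis
    using False assms xlog_ge_tangent(1)[of \<beta> c]
    by (simp add: partial_lin_xlog lin_const_xlog algebra_simps)
qed

definition h_argmax :: "real \<Rightarrow> real \<Rightarrow> real \<Rightarrow> real" where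
  "h_argmax \<alpha> \<beta> e =
     (if e / (\<alpha> + 1) > ln \<beta> + 1 then exp (e / (1 + \<alpha>) - 1)
      else exp (e - 1 - \<alpha> * (ln \<beta> + 1)))"

definition h_max :: "real \<Rightarrow> real \<Rightarrow> real \<Rightarrow> real" where
  "h_max \<alpha> \<beta> e =
     (if e / (\<alpha> + 1) > ln \<beta> + 1
      then (1 + \<alpha>) * exp (e / (1 + \<alpha>) - 1) + (- \<alpha> * lin_const xlog \<beta>)
      else exp (e - 1 - \<alpha> * (ln \<beta> + 1)) + \<alpha> * (ln \<beta> + 1))"

lemma omega_star_eq_h_argmax:
  "omega_star \<alpha> \<beta> \<gamma> T dE dU v x = h_argmax \<alpha> \<beta> (e_fun \<gamma> T dE dU v x)"
  by (simp add: omega_star_def h_argmax_def Let_def)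

lemma h_argmax_nonneg: "h_argmax \<alpha> \<beta> e \<ge> 0"
  by (simp add: h_argmax_def)

text \<open>The threshold on \<open>e\<close> decides on which side of \<open>\<beta>\<close> the
  candidate falls, and so which branch of \<open>partial_lin\<close> is evaluated.\<close>

lemma h_fun_argmax:
  assumes "\<alpha> > 0" "\<beta> > 0"
  shows "h_fun \<alpha> \<beta> e (h_argmax \<alpha> \<beta> e) = h_max \<alpha> \<beta> e"
proof (cases "e / (\<alpha> + 1) > ln \<beta> + 1")
  case True
  define c where "c = e / (1 + \<alpha>)"
  define w where "w = exp (c - 1)"
  have e: "e = (1 + \<alpha>) * c" and "c > ln \<beta> + 1"
    using assms True by (simp_all add: c_def add.commute)
  moreover have "w > 0"
    by (simp add: w_def)
  ultimately have "w > \<beta>"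
    using assms ln_less_cancel_iff[of \<beta> w] by (simp add: w_def)
  \<comment> \<open>Substituting this for \<open>c\<close> cancels all terms in
    \<open>w * ln w\<close>.\<close>
  moreover have "c = ln w + 1"
    by (simp add: w_def)
  ultimately have "h_fun \<alpha> \<beta> e w = (1 + \<alpha>) * w - \<alpha> * lin_const xlog \<beta>"
    using assms by (simp add: h_fun_def partial_lin_xlog e algebra_simps)
  then show ?thesis
    using True by (simp add: h_argmax_def h_max_def w_def c_def)
next
  case False
  define w where "w = exp (e - 1 - \<alpha> * (ln \<beta> + 1))"
  have "e \<le> (1 + \<alpha>) * (ln \<beta> + 1)"
    using False assms by (simp add: field_simps)
  then have "ln w \<le> ln \<beta>"
    by (simp add: w_def algebra_simps)
  moreover have "w > 0"
    by (simp add: w_def)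
  ultimately have "w \<le> \<beta>"
    using assms by simp
  \<comment> \<open>The two branches of \<^const>\<open>partial_lin\<close> agree at \<open>\<beta>\<close>.\<close>
  then have "partial_lin xlog \<beta> w = (ln \<beta> + 1) * (w - 1)"
    using assms by (auto simp: partial_lin_xlog lin_const_xlog algebra_simps)
  moreover have "e = ln w + 1 + \<alpha> * (ln \<beta> + 1)"
    by (simp add: w_def)
  ultimately have "h_fun \<alpha> \<beta> e w = w + \<alpha> * (ln \<beta> + 1)"
    unfolding h_fun_def by (simp only:) (simp add: algebra_simps)
  then show ?thesis
    using False by (simp add: h_argmax_def h_max_def w_def)
qed

lemma h_fun_less_max:
  assumes "\<alpha> > 0" "\<beta> > 0" "w \<ge> 0" "w \<noteq> h_argmax \<alpha> \<beta> e"
  shows "h_fun \<alpha> \<beta> e w < h_max \<alpha> \<beta> e"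
proof (cases "e / (\<alpha> + 1) > ln \<beta> + 1")
  case True
  \<comment> \<open>The two tangents enter with weights \<open>1\<close> and
    \<open>\<alpha>\<close>; giving both the slope \<open>c\<close> makes the total slope
    \<open>e\<close> and the common contact point the maximizer.\<close>
  define c where "c = e / (1 + \<alpha>)"
  have e: "e = (1 + \<alpha>) * c" and c: "c > ln \<beta> + 1"
    using assms True by (simp_all add: c_def add.commute)
  have "\<alpha> * partial_lin xlog \<beta> w \<ge> \<alpha> * (c * w - exp (c - 1) + lin_const xlog \<beta>)"
    using assms c by (intro mult_left_mono partial_lin_xlog_ge_tangent) auto
  moreover have "w * ln w > c * w - exp (c - 1)"
    using xlog_ge_tangent[of w c] assms True by (simp add: h_argmax_def c_def less_le)
  ultimately have "h_fun \<alpha> \<beta> e w < (1 + \<alpha>) * exp (c - 1) - \<alpha> * lin_const xlog \<beta>"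
    by (simp add: h_fun_def e algebra_simps)
  then show ?thesis
    using True by (simp add: h_max_def c_def)
next
  case False
  \<comment> \<open>The linear branch uses up the slope \<open>\<alpha> * (ln \<beta> + 1)\<close>;
    the remainder \<open>c\<close> goes to the tangent of \<open>w * ln w\<close>.\<close>
  define c where "c = e - \<alpha> * (ln \<beta> + 1)"
  have c: "e - 1 - \<alpha> * (ln \<beta> + 1) = c - 1" and e: "e = c + \<alpha> * (ln \<beta> + 1)"
    by (simp_all add: c_def)
  have "\<alpha> * partial_lin xlog \<beta> w \<ge> \<alpha> * ((ln \<beta> + 1) * (w - 1))"
    using assms by (intro mult_left_mono partial_lin_xlog_ge_linear) auto
  moreover have "w * ln w > c * w - exp (c - 1)"
    using xlog_ge_tangent[of w c] assms False by (simp add: h_argmax_def c less_le)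
  ultimately have "h_fun \<alpha> \<beta> e w < exp (c - 1) + \<alpha> * (ln \<beta> + 1)"
    by (simp add: h_fun_def e algebra_simps)
  then show ?thesis
    using False by (simp add: h_max_def c)
qed

text \<open>A point of the support has positive mass, so the singleton \<open>{y}\<close> is already
  a non-null set of strict inequality.\<close>

lemma integral_pmf_strict_mono:
  fixes f g :: "'a \<Rightarrow> real"
  assumes "integrable (measure_pmf p) f" "integrable (measure_pmf p) g"
    and "\<And>x. x \<in> set_pmf p \<Longrightarrow> f x \<le> g x" and "y \<in> set_pmf p" "f y < g y"
  shows "measure_pmf.expectation p f < measure_pmf.expectation p g"
proof (rule measure_pmf.integral_less_AE[OF assms(1,2), of "{y}"])
  show "emeasure (measure_pmf p) {y} \<noteq> 0"
    using assms(4) by (simp add: emeasure_pmf_single pmf_eq_0_set_pmf)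
  show "AE x in measure_pmf p. x \<in> {y} \<longrightarrow> f x \<noteq> g x"
    using assms(5) by (simp add: AE_measure_pmf_iff)
qed (use assms(3) in \<open>auto simp: AE_measure_pmf_iff\<close>)

theorem theorem2:
  fixes T :: "'s::countable \<Rightarrow> 'a::countable \<Rightarrow> 's pmf"
    and p0 :: "'s pmf"
    and \<pi>E \<pi>U :: "'s \<Rightarrow> 'a pmf"
    and dE dU :: "('s \<times> 'a) pmf"
    and \<alpha> \<beta> \<gamma> :: real
    and v :: "'s \<Rightarrow> real"
  assumes gamma: "0 \<le> \<gamma>" "\<gamma> < 1"
    and alpha: "\<alpha> > 0"
    and beta: "\<beta> > 1"
    and dE: "\<And>x. pmf dE x = occupancy \<gamma> p0 T \<pi>E x"
    and dU: "\<And>x. pmf dU x = occupancy \<gamma> p0 T \<pi>U x"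
    and dE_pos: "\<And>x. pmf dE x > 0"
    and dU_pos: "\<And>x. pmf dU x > 0"
    and v_T: "\<And>s a. (\<lambda>s'. \<bar>pmf (T s a) s' * v s'\<bar>) summable_on UNIV"
    and v_p0: "integrable (measure_pmf p0) v"
    and h_star: "integrable (measure_pmf dU)
          (\<lambda>x. h_fun \<alpha> \<beta> (e_fun \<gamma> T dE dU v x) (omega_star \<alpha> \<beta> \<gamma> T dE dU v x))"
  shows "{\<omega>. is_arg_max (\<lambda>\<omega>. L_obj \<alpha> \<beta> \<gamma> p0 T dE dU \<omega> v)
                (admissible \<alpha> \<beta> \<gamma> T dE dU v) \<omega>}
           = {omega_star \<alpha> \<beta> \<gamma> T dE dU v}
       \<and> (\<forall>s a. h_fun \<alpha> \<beta> (e_fun \<gamma> T dE dU v (s, a)) (omega_star \<alpha> \<beta> \<gamma> T dE dU v (s, a)) =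
            (if e_fun \<gamma> T dE dU v (s, a) / (\<alpha> + 1) > ln \<beta> + 1
             then (1 + \<alpha>) * exp (e_fun \<gamma> T dE dU v (s, a) / (1 + \<alpha>) - 1) + (- \<alpha> * lin_const xlog \<beta>)
             else exp (e_fun \<gamma> T dE dU v (s, a) - 1 - \<alpha> * (ln \<beta> + 1)) + \<alpha> * (ln \<beta> + 1)))"
proof -
  define e where "e = e_fun \<gamma> T dE dU v"
  define w where "w = omega_star \<alpha> \<beta> \<gamma> T dE dU v"
  have beta0: "\<beta> > 0"
    using beta by simp
  have w_eq: "w x = h_argmax \<alpha> \<beta> (e x)" for x
    by (simp add: w_def e_def omega_star_eq_h_argmax)
  have h_w: "h_fun \<alpha> \<beta> (e x) (w x) = h_max \<alpha> \<beta> (e x)" for x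
    using h_fun_argmax[OF alpha beta0] by (simp add: w_eq)
  \<comment> \<open>By \<open>h_star\<close> the candidate itself competes in the
    maximization.\<close>
  have adm_w: "admissible \<alpha> \<beta> \<gamma> T dE dU v w"
    using h_star by (simp add: admissible_def w_eq h_argmax_nonneg flip: w_def e_def)
  have less: "L_obj \<alpha> \<beta> \<gamma> p0 T dE dU \<omega> v < L_obj \<alpha> \<beta> \<gamma> p0 T dE dU w v"
    if adm: "admissible \<alpha> \<beta> \<gamma> T dE dU v \<omega>" and neq: "\<omega> \<noteq> w" for \<omega>
  proof -
    obtain y where y: "\<omega> y \<noteq> w y"
      using neq by blast
    have strict: "h_fun \<alpha> \<beta> (e x) (\<omega> x) < h_fun \<alpha> \<beta> (e x) (w x)" if "\<omega> x \<noteq> w x" for x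
      using h_fun_less_max[OF alpha beta0, of "\<omega> x" "e x"] adm that
      unfolding h_w by (simp add: w_eq admissible_def del: split_paired_All)
    have "measure_pmf.expectation dU (\<lambda>x. h_fun \<alpha> \<beta> (e x) (\<omega> x))
        < measure_pmf.expectation dU (\<lambda>x. h_fun \<alpha> \<beta> (e x) (w x))"
    proof (rule integral_pmf_strict_mono)
      show "h_fun \<alpha> \<beta> (e x) (\<omega> x) \<le> h_fun \<alpha> \<beta> (e x) (w x)" for x
        using strict[of x] by fastforce
      show "y \<in> set_pmf dU"
        using dU_pos by (simp add: set_pmf_iff less_imp_neq[symmetric])
    qed (use adm adm_w strict y in \<open>auto simp: admissible_def e_def\<close>)
    \<comment> \<open>The \<open>p0\<close> term is the same for \<open>\<omega>\<close> and
      \<open>w\<close>, so only the integrals over \<open>dU\<close> matter.\<close>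
    then show ?thesis
      by (simp add: L_obj_def e_def)
  qed
  \<comment> \<open>The strict inequality gives both directions: nothing admissible exceeds
    \<open>w\<close>, and every other admissible function is beaten by \<open>w\<close>.\<close>
  have "is_arg_max (\<lambda>\<omega>. L_obj \<alpha> \<beta> \<gamma> p0 T dE dU \<omega> v)
      (admissible \<alpha> \<beta> \<gamma> T dE dU v) \<omega> \<longleftrightarrow> \<omega> = w" for \<omega>
    unfolding is_arg_max_def using less adm_w by (metis less_asym less_irrefl)
  then show ?thesis
    using h_w unfolding h_max_def w_def e_def by blast
qed

end
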